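(* Let $Q\subset\mathbb{R}^d_{\ge 0}\setminus\{\mathbf{0}\}$ be a polytope, let $q\ge 1$, and let $f$ be $q$-homogeneous and convex on $\operatorname{conv}(Q\cup\{\mathbf{0}\})$. Then $$\int_0^1 z^d\int_Q f(z\mathbf{x})\,d\mathbf{x}\,dz=\frac{1}{q+d+1}\int_{Q}f(\mathbf{x})\,d\mathbf{x}.$$
   Context: $f$ is $q$-homogeneous if $f(\lambda\mathbf{x})=\lambda^q f(\mathbf{x})$ for all $\lambda\ge 0$ (whenever $\mathbf{x}$ and $\lambda\mathbf{x}$ lie in the domain of $f$); in particular $f(\mathbf{0})=0$. Integrals over $Q$ are with respect to Lebesgue measure in $\mathbb{R}^d$. *)

theory Defs
  imports "HOL-Analysis.Analysis"
begin

text \<open>The exponent is real. Since \<open>0 powr q = 0\<close>, the case \<open>c = 0\<close> yields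
  \<open>f 0 = 0\<close> as soon as \<open>D\<close> contains the origin.\<close>

definition homogeneous_on :: "real \<Rightarrow> 'a::real_vector set \<Rightarrow> ('a \<Rightarrow> real) \<Rightarrow> bool" where
  "homogeneous_on q D f \<longleftrightarrow>
     (\<forall>x\<in>D. \<forall>c\<ge>0. c *\<^sub>R x \<in> D \<longrightarrow> f (c *\<^sub>R x) = c powr q * f x)"

end

theory Submission
  imports Defs
begin

text \<open>For \<open>x\<close> in \<open>Q\<close> and \<open>0 \<le> z \<le> 1\<close> both \<open>x\<close> and \<open>z x\<close> lie in the convex hull of \<open>Q\<close> and
  the origin, so homogeneity gives \<open>f (z x) = z powr q * f x\<close>. Hence the inner integral is
  \<open>z powr q\<close> times the integral of \<open>f\<close> over \<open>Q\<close>, and the identity reduces to the integral of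
  \<open>z powr (q + d)\<close> over the unit interval.

  Convexity enters only through integrability. If the polytope has empty interior, it is
  negligible. Otherwise a convex function on it is bounded above by its maximum on the vertices
  and bounded below, because a fixed interior point is a convex combination, with weights
  independent of \<open>x\<close>, of the given point \<open>x\<close> and a point of a small ball; it is continuous in
  the interior, and the frontier of a convex set is negligible
  (\<open>convex_on_polytope_absolutely_integrable\<close>).\<close>

lemma convex_on_polytope_bounded_above:
  fixes f :: "'a::euclidean_space \<Rightarrow> real"
  assumes "polytope Q" "convex_on Q f"
  obtains M where "\<And>x. x \<in> Q \<Longrightarrow> f x \<le> M"
proof -
  obtain V where V: "finite V" "Q = convex hull V"
    using assms(1) unfolding polytope_def by blast
  have "\<forall>x\<in>V. f x \<le> Max (f ` V)"
    using V(1) by simp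
  then have "\<forall>x\<in>convex hull V. f x \<le> Max (f ` V)"
    using assms(2) V(2) convex_on_convex_hull_bound by metis
  then show ?thesis
    using that V(2) by blast
qed

lemma convex_on_bounded_below:
  fixes f :: "'a::real_normed_vector \<Rightarrow> real"
  assumes "bounded Q" and cvx: "convex_on Q f" and "interior Q \<noteq> {}"
    and M: "\<And>x. x \<in> Q \<Longrightarrow> f x \<le> M"
  obtains m where "\<And>x. x \<in> Q \<Longrightarrow> m \<le> f x"
proof -
  obtain c e where e: "e > 0" "cball c e \<subseteq> Q"
    using assms(3) by (metis all_not_in_conv mem_interior_cball)
  obtain B where B: "B > 0" "\<And>x. x \<in> Q \<Longrightarrow> norm (x - c) \<le> B"
  proof -
    obtain B where "\<forall>x\<in>Q. dist c x \<le> B"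
      using assms(1) bounded_any_center by metis
    then show ?thesis
      using that[of "max 1 B"] by (force simp: dist_norm norm_minus_commute)
  qed
  \<comment> \<open>This scale factor moves every point of \<open>Q\<close>, seen from \<open>c\<close>, into the ball of radius \<open>e\<close>.\<close>
  define t where "t = e / B"
  have t: "t > 0" "t * B = e"
    using e B by (auto simp: t_def)
  have "((1 + t) * f c - M) / t \<le> f x" if x: "x \<in> Q" for x
  proof -
    \<comment> \<open>The point opposite to \<open>x\<close>: \<open>c\<close> divides the segment from \<open>y\<close> to \<open>x\<close> in the ratio \<open>t : 1\<close>.\<close>
    define y where "y = c - t *\<^sub>R (x - c)"
    have "t * norm (x - c) \<le> t * B"
      using B(2)[OF x] t(1) by simp
    then have "y \<in> cball c e"
      using t by (simp add: y_def dist_norm)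
    then have y: "y \<in> Q"
      using e by blast
    have "c = (1 / (1 + t)) *\<^sub>R y + (t / (1 + t)) *\<^sub>R x"
    proof -
      have "(1 / (1 + t)) *\<^sub>R y + (t / (1 + t)) *\<^sub>R x = (1 / (1 + t)) *\<^sub>R (y + t *\<^sub>R x)"
        by (simp add: scaleR_add_right)
      also have "y + t *\<^sub>R x = (1 + t) *\<^sub>R c"
        by (simp add: y_def algebra_simps)
      finally show ?thesis
        using t by simp
    qed
    moreover have "1 / (1 + t) + t / (1 + t) = 1"
      using t by (simp add: field_simps)
    ultimately have "f c \<le> 1 / (1 + t) * f y + t / (1 + t) * f x"
      using cvx x y t unfolding convex_on_def by (metis less_eq_real_def add_pos_pos
          divide_nonneg_pos zero_less_one)
    also have "\<dots> \<le> 1 / (1 + t) * M + t / (1 + t) * f x"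
      using M[OF y] t by (simp add: divide_right_mono)
    also have "\<dots> = (M + t * f x) / (1 + t)"
      by (simp add: add_divide_distrib)
    finally have "(1 + t) * f c \<le> M + t * f x"
      using t by (simp add: pos_le_divide_eq mult.commute)
    then show ?thesis
      using t by (simp add: field_simps)
  qed
  then show ?thesis
    using that by blast
qed

lemma convex_on_polytope_absolutely_integrable:
  fixes f :: "'a::euclidean_space \<Rightarrow> real"
  assumes Q: "polytope Q" and cvx: "convex_on Q f"
  shows "f absolutely_integrable_on Q"
proof (cases "interior Q = {}")
  case True
  then have "negligible Q"
    using Q negligible_convex_interior polytope_imp_convex by blast
  then show ?thesis
    using absolutely_integrable_negligible by blast
next
  case False
  obtain M where M: "\<And>x. x \<in> Q \<Longrightarrow> f x \<le> M"
    using convex_on_polytope_bounded_above[OF Q cvx] by blast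
  obtain m where m: "\<And>x. x \<in> Q \<Longrightarrow> m \<le> f x"
    using convex_on_bounded_below[OF polytope_imp_bounded[OF Q] cvx False M] by blast
  have bdd: "norm (f x) \<le> max \<bar>m\<bar> \<bar>M\<bar>" if "x \<in> interior Q" for x
    using M[of x] m[of x] that interior_subset by fastforce
  have "convex_on (interior Q) f"
    using cvx convex_interior[OF polytope_imp_convex[OF Q]] interior_subset
    by (meson convex_on_subset)
  then have "continuous_on (interior Q) f"
    using convex_on_continuous open_interior by blast
  then have meas: "f \<in> borel_measurable (lebesgue_on (interior Q))"
    by (simp add: continuous_imp_measurable_on_sets_lebesgue)
  have "interior Q \<in> lmeasurable"
    by (meson Q bounded_interior lmeasurable_open open_interior polytope_imp_bounded)
  then have const: "(\<lambda>x. max \<bar>m\<bar> \<bar>M\<bar>) integrable_on interior Q"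
    using integrable_on_const by blast
  have "f absolutely_integrable_on interior Q"
    by (rule measurable_bounded_by_integrable_imp_absolutely_integrable[OF meas _ const bdd]) auto
  moreover have "negligible {x \<in> interior Q - Q. f x \<noteq> 0}"
    using interior_subset[of Q] by (auto intro: empty_imp_negligible)
  moreover have "negligible (Q - interior Q)"
    using negligible_convex_frontier[OF polytope_imp_convex[OF Q]] polytope_imp_closed[OF Q]
    by (simp add: frontier_def)
  then have "negligible {x \<in> Q - interior Q. f x \<noteq> 0}"
    by (rule negligible_subset) auto
  ultimately show ?thesis
    by (rule absolutely_integrable_spike_set)
qed

theorem lemma2p5:
  fixes Q :: "(real ^ 'd) set" and f :: "real ^ 'd \<Rightarrow> real" and q :: real
  assumes "polytope Q"
    and "Q \<subseteq> {x. \<forall>i. 0 \<le> x $ i} - {0}"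
    and "q \<ge> 1"
    and "homogeneous_on q (convex hull (Q \<union> {0})) f"
    and "convex_on (convex hull (Q \<union> {0})) f"
  shows "set_integrable lebesgue Q f \<and>
    (\<forall>z\<in>{0..1}. set_integrable lebesgue Q (\<lambda>x. f (z *\<^sub>R x))) \<and>
    set_integrable lebesgue {0..1}
      (\<lambda>z::real. z ^ CARD('d) * (LINT x:Q|lebesgue. f (z *\<^sub>R x))) \<and>
    (LINT z:{0..1::real}|lebesgue. z ^ CARD('d) * (LINT x:Q|lebesgue. f (z *\<^sub>R x)))
      = 1 / (q + real CARD('d) + 1) * (LINT x:Q|lebesgue. f x)"
proof -
  let ?C = "convex hull (Q \<union> {0})"
  define I where "I = (LINT x:Q|lebesgue. f x)"
  define p where "p = q + real CARD('d)"
  have p: "p > 0"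
    using assms(3) by (simp add: p_def)
  have QC: "Q \<subseteq> ?C"
    using hull_subset[of "Q \<union> {0}" convex] by auto
  have Q: "Q \<in> sets lebesgue"
    using assms(1) by (simp add: borel_closed polytope_imp_closed)
  have "convex_on Q f"
    using assms(5) QC polytope_imp_convex[OF assms(1)] by (meson convex_on_subset)
  then have int: "set_integrable lebesgue Q f"
    using assms(1) convex_on_polytope_absolutely_integrable by blast
  have hom: "f (z *\<^sub>R x) = z powr q * f x" if "x \<in> Q" "z \<in> {0..1}" for x z
  proof -
    have "0 \<in> ?C"
      by (simp add: hull_inc)
    then have "z *\<^sub>R x + (1 - z) *\<^sub>R 0 \<in> ?C"
      using that QC by (intro convexD[OF convex_convex_hull]) auto
    then show ?thesis
      using that QC assms(4) unfolding homogeneous_on_def by auto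
  qed
  have scaled: "set_integrable lebesgue Q (\<lambda>x. f (z *\<^sub>R x))" if "z \<in> {0..1}" for z
    using set_integrable_mult_right[of "z powr q" lebesgue Q f] int hom that
    by (subst set_integrable_cong[of _ lebesgue _ Q _ "\<lambda>x. z powr q * f x"]) auto
  have inner: "z ^ CARD('d) * (LINT x:Q|lebesgue. f (z *\<^sub>R x)) = z powr p * I"
    if "z \<in> {0..1}" for z
  proof -
    have "(LINT x:Q|lebesgue. f (z *\<^sub>R x)) = (LINT x:Q|lebesgue. z powr q * f x)"
      using hom that Q by (intro set_lebesgue_integral_cong) auto
    also have "\<dots> = z powr q * I"
      by (simp add: I_def)
    \<comment> \<open>At \<open>z = 0\<close> both sides vanish, since \<open>0 powr p = 0\<close>.\<close>
    finally show ?thesis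
      using that by (cases "z = 0") (auto simp: p_def powr_add powr_realpow)
  qed
  have "continuous_on {0..1} (\<lambda>z::real. z powr p)"
    using p by (intro continuous_on_powr') (auto intro!: continuous_intros)
  then have pint: "(\<lambda>z::real. z powr p) absolutely_integrable_on {0..1}"
    by (rule absolutely_integrable_continuous_real)
  then have "set_integrable lebesgue {0..1} (\<lambda>z::real. z powr p * I)"
    by simp
  with inner have "set_integrable lebesgue {0..1}
      (\<lambda>z::real. z ^ CARD('d) * (LINT x:Q|lebesgue. f (z *\<^sub>R x)))"
    by (subst set_integrable_cong[OF refl refl]) auto
  moreover have "(LINT z:{0..1::real}|lebesgue. z ^ CARD('d) * (LINT x:Q|lebesgue. f (z *\<^sub>R x)))
      = (LINT z:{0..1::real}|lebesgue. z powr p * I)"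
    using inner by (intro set_lebesgue_integral_cong) auto
  moreover have "(LINT z:{0..1::real}|lebesgue. z powr p) = 1 / (p + 1)"
    using set_lebesgue_integral_eq_integral(2)[OF pint] has_integral_powr_from_0[of p 1] p
    by (simp add: integral_unique)
  ultimately show ?thesis
    using int scaled by (simp add: I_def p_def)
qed

end
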